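(* Let $\frac12<H<1$ and let $G_1,G_2\in C^\infty(\mathbb R)$ have compact supports. Then for all $r,s>0$ with $r\neq s$ and all $a,b\in\mathbb R$, $$ \begin{aligned} \int_{\mathbb R^2}G_1'(x-a)G_2'(y-b)\varphi_{s,r}(x,y)\,dx\,dy&=\int_{\mathbb R^2}G_1'(x-a)G_2'(y-b)\Psi_{s,r,a,b}(x,y)\,dx\,dy\\ &\quad-G_2(1)\int_{\mathbb R}G_1(x-a)\frac{\partial}{\partial x}\varphi_{s,r}(x,b)\,dx\\ &\quad-G_1(1)\int_{\mathbb R}G_2(y-b)\frac{\partial}{\partial y}\varphi_{s,r}(a,y)\,dy-\varphi_{s,r}(a,b)G_1(1)G_2(1). \end{aligned} $$ Moreover, if $G_1(1)=G_2(1)=0$, then $$ \int_{\mathbb R^2}G_1'(x-a)G_2'(y-b)\varphi_{s,r}(x,y)\,dx\,dy=\int_{\mathbb R^2}G_1'(x-a)G_2'(y-b)\Psi_{s,r,a,b}(x,y)\,dx\,dy . $$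
   Context: $B^H$ is a fractional Brownian motion with Hurst index $H$ (centered Gaussian, $E[B^H_tB^H_s]=\frac12(t^{2H}+s^{2H}-|t-s|^{2H})$). With $\mu_{s,r}=E(B^H_sB^H_r)$ and $\rho_{s,r}^2=(rs)^{2H}-\mu_{s,r}^2$, $\varphi_{s,r}(x,y)=\frac1{2\pi\rho_{s,r}}\exp\{-\frac1{2\rho^2_{s,r}}(r^{2H}x^2-2\mu_{s,r}xy+s^{2H}y^2)\}$ is the density of $(B^H_s,B^H_r)$. With $\theta(x)=1_{\{x>0\}}$, $$\Psi_{s,r,a,b}(x,y)=\varphi_{s,r}(x,y)-\varphi_{s,r}(x,b)\theta(1+b-y)-\varphi_{s,r}(a,y)\theta(1+a-x)+\varphi_{s,r}(a,b)\theta(1+a-x)\theta(1+b-y).$$ *)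

theory Defs
  imports "HOL-Probability.Probability"
begin

definition smooth :: "(real \<Rightarrow> real) \<Rightarrow> bool" where
  "smooth f \<longleftrightarrow> (\<forall>n. (deriv ^^ n) f differentiable_on UNIV)"

definition has_compact_support :: "(real \<Rightarrow> real) \<Rightarrow> bool" where
  "has_compact_support f \<longleftrightarrow> compact (closure (support_on UNIV f))"

(* The Dirac mass at 0 counts as a (degenerate) centered Gaussian law: it is needed for the
   process at time 0 and for vanishing linear combinations. *)
definition centered_gaussian :: "'w measure \<Rightarrow> ('w \<Rightarrow> real) \<Rightarrow> bool" where
  "centered_gaussian M X \<longleftrightarrow> X \<in> borel_measurable M \<and>
     (distr M borel X = return borel 0 \<or>
      (\<exists>\<sigma>>0. distributed M lborel X (normal_density 0 \<sigma>)))"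

definition centered_gaussian_process ::
  "'w measure \<Rightarrow> 't set \<Rightarrow> ('t \<Rightarrow> 'w \<Rightarrow> real) \<Rightarrow> bool" where
  "centered_gaussian_process M T X \<longleftrightarrow>
     (\<forall>I c. finite I \<and> I \<subseteq> T \<longrightarrow> centered_gaussian M (\<lambda>\<omega>. \<Sum>t\<in>I. c t * X t \<omega>))"

(* Only the values B t with t \<ge> 0 are constrained. *)
definition fractional_brownian_motion ::
  "'w measure \<Rightarrow> real \<Rightarrow> (real \<Rightarrow> 'w \<Rightarrow> real) \<Rightarrow> bool" where
  "fractional_brownian_motion M H B \<longleftrightarrow>
     prob_space M \<and> 0 < H \<and> H < 1 \<and>
     centered_gaussian_process M {0..} B \<and>
     (\<forall>t\<ge>0. \<forall>s\<ge>0. (\<integral>\<omega>. B t \<omega> * B s \<omega> \<partial>M)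
        = 1 / 2 * (t powr (2 * H) + s powr (2 * H) - \<bar>t - s\<bar> powr (2 * H)))"

definition mu :: "'w measure \<Rightarrow> (real \<Rightarrow> 'w \<Rightarrow> real) \<Rightarrow> real \<Rightarrow> real \<Rightarrow> real" where
  "mu M B s r = (\<integral>\<omega>. B s \<omega> * B r \<omega> \<partial>M)"

definition rho ::
  "'w measure \<Rightarrow> (real \<Rightarrow> 'w \<Rightarrow> real) \<Rightarrow> real \<Rightarrow> real \<Rightarrow> real \<Rightarrow> real" where
  "rho M B H s r = sqrt ((r * s) powr (2 * H) - (mu M B s r)\<^sup>2)"

definition phi ::
  "'w measure \<Rightarrow> (real \<Rightarrow> 'w \<Rightarrow> real) \<Rightarrow> real \<Rightarrow> real \<Rightarrow> real \<Rightarrow> real \<Rightarrow> real \<Rightarrow> real" where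
  "phi M B H s r x y =
     1 / (2 * pi * rho M B H s r) *
     exp (- (1 / (2 * (rho M B H s r)\<^sup>2)) *
       (r powr (2 * H) * x\<^sup>2 - 2 * mu M B s r * x * y + s powr (2 * H) * y\<^sup>2))"

definition theta :: "real \<Rightarrow> real" where
  "theta x = (if x > 0 then 1 else 0)"

definition Psi ::
  "'w measure \<Rightarrow> (real \<Rightarrow> 'w \<Rightarrow> real) \<Rightarrow> real \<Rightarrow> real \<Rightarrow> real \<Rightarrow> real \<Rightarrow> real \<Rightarrow> real \<Rightarrow> real \<Rightarrow> real"
  where
  "Psi M B H s r a b x y =
     phi M B H s r x y
     - phi M B H s r x b * theta (1 + b - y)
     - phi M B H s r a y * theta (1 + a - x)
     + phi M B H s r a b * theta (1 + a - x) * theta (1 + b - y)"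

end

theory Submission
  imports Defs
begin

text \<open>
  The three correction terms of \<open>\<Psi>\<close> are products of a function of \<open>x\<close> and a function of \<open>y\<close>,
  so their integrals factor. A factor \<open>\<integral> G'(x - a) \<theta>(1 + a - x) dx\<close> equals \<open>G 1\<close> by the fundamental
  theorem of calculus, and a factor \<open>\<integral> G'(x - a) \<phi>(x, b) dx\<close> is integrated by parts.
\<close>

lemma smooth_continuously_differentiable:
  assumes "smooth G"
  shows "(G has_real_derivative deriv G x) (at x)"
    and "continuous_on UNIV (deriv G)"
proof -
  \<comment> \<open>Order 0 supplies the derivative of \<open>G\<close>; order 1 makes
    \<open>deriv G\<close> differentiable, hence continuous.\<close>
  have "(deriv ^^ 0) G differentiable_on UNIV" "(deriv ^^ 1) G differentiable_on UNIV"
    using assms unfolding smooth_def by blast+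
  then show "(G has_real_derivative deriv G x) (at x)" "continuous_on UNIV (deriv G)"
    by (auto simp: differentiable_on_def DERIV_deriv_iff_real_differentiable
        intro!: differentiable_imp_continuous_on)
qed

text \<open>Off a bounded interval containing the support, \<open>G\<close> is locally constant, so
  its derivative is zero there as well. A single radius for both functions lets later integrals over
  the line be restricted to an interval.\<close>

lemma has_compact_support_vanishes:
  assumes "smooth G" "has_compact_support G"
  obtains R where "R > 0" "\<And>x. R \<le> \<bar>x\<bar> \<Longrightarrow> G x = 0" "\<And>x. R \<le> \<bar>x\<bar> \<Longrightarrow> deriv G x = 0"
proof -
  have "bounded (support_on UNIV G)"
    using assms(2) unfolding has_compact_support_def
    by (meson bounded_subset closure_subset compact_imp_bounded)
  then obtain K where K: "K > 0" "\<And>x. G x \<noteq> 0 \<Longrightarrow> \<bar>x\<bar> \<le> K"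
    unfolding bounded_pos support_on_def by auto
  have G0: "G x = 0" if "K < \<bar>x\<bar>" for x
    using K(2)[of x] that by auto
  have "deriv G x = 0" if "K < \<bar>x\<bar>" for x
  proof -
    \<comment> \<open>\<open>\<bar>x\<bar> - K\<close> is the distance from \<open>x\<close> to
      \<open>{- K..K}\<close>, so the open interval of this radius around \<open>x\<close> stays
      where \<open>G\<close> is zero.\<close>
    have "0 < \<bar>x\<bar> - K" using that by simp
    moreover have "\<forall>y. \<bar>x - y\<bar> < \<bar>x\<bar> - K \<longrightarrow> G x = G y"
    proof (intro allI impI)
      fix y assume "\<bar>x - y\<bar> < \<bar>x\<bar> - K"
      then have "K < \<bar>y\<bar>" by linarith
      then show "G x = G y" using that by (simp add: G0)
    qed
    ultimately have "(G has_real_derivative deriv G x) (at x) \<Longrightarrow> deriv G x = 0"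
      by (intro DERIV_local_const)
    then show ?thesis
      using smooth_continuously_differentiable(1)[OF assms(1)] by blast
  qed
  then show thesis
    \<comment> \<open>Both functions vanish for \<open>K < \<bar>x\<bar>\<close>; enlarging the
      radius by 1 covers the endpoints \<open>R\<close> and \<open>- R\<close>, where boundary
      values are evaluated later.\<close>
    using that[of "K + 1"] K(1) G0 by force
qed

text \<open>The factor \<open>theta\<close> cuts the integral off at \<open>1 + a\<close>, where the
  shifted function takes the value \<open>G 1\<close>; the compact support kills the contribution
  from the far left.\<close>

lemma has_bochner_integral_deriv_theta:
  assumes "smooth G" "has_compact_support G"
  shows "has_bochner_integral lborel (\<lambda>x. deriv G (x - a) * theta (1 + a - x)) (G 1)"
proof -
  obtain R where R: "R > 0" "\<And>x. R \<le> \<bar>x\<bar> \<Longrightarrow> G x = 0" "\<And>x. R \<le> \<bar>x\<bar> \<Longrightarrow> deriv G x = 0"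
    by (rule has_compact_support_vanishes[OF assms(1,2)]) blast
  note [continuous_intros] =
    continuous_on_compose2[OF smooth_continuously_differentiable(2)[OF assms(1)]]
  have [measurable]: "(\<lambda>x. deriv G (x - a)) \<in> borel_measurable borel"
    by (intro borel_measurable_continuous_onI continuous_intros) auto
  have [measurable]: "theta \<in> borel_measurable borel"
    unfolding theta_def by measurable
  have "isCont (\<lambda>x. deriv G (x - a)) x" for x
    by (rule continuous_on_interior[of UNIV]) (auto intro!: continuous_intros)
  moreover have "((\<lambda>x. G (x - a)) has_real_derivative deriv G (x - a)) (at x)" for x
    using DERIV_shift[of G "deriv G (x - a)" x "- a", simplified]
      smooth_continuously_differentiable(1)[OF assms(1)] by blast
  ultimately have "has_bochner_integral lborel
      (\<lambda>x. deriv G (x - a) * indicator {a - R..1 + a} x) (G (1 + a - a) - G (a - R - a))"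
    if "a - R \<le> 1 + a"
    using that by (intro has_bochner_integral_FTC_Icc_real)
  \<comment> \<open>\<open>R > 0\<close> gives the ordering of the endpoints, and
    \<open>G (- R) = 0\<close> removes the lower boundary value.\<close>
  then have "has_bochner_integral lborel
      (\<lambda>x. deriv G (x - a) * indicator {a - R..1 + a} x) (G 1)"
    using R(1) R(2)[of "- R"] by simp
  \<comment> \<open>The indicator includes \<open>1 + a\<close> while \<open>theta 0 = 0\<close>, so
    the two integrands may differ at that single point. To the left of \<open>a - R\<close> both are
    zero.\<close>
  moreover have "AE x in lborel. deriv G (x - a) * indicator {a - R..1 + a} x
      = deriv G (x - a) * theta (1 + a - x)"
    using AE_lborel_singleton[of "1 + a"]
  proof eventually_elim
    case (elim x)
    have "deriv G (x - a) = 0" if "x < a - R"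
      using R(3)[of "x - a"] that by simp
    then show ?case using elim by (auto simp: theta_def indicator_def)
  qed
  ultimately show ?thesis
    by (subst (asm) has_bochner_integral_cong_AE) auto
qed

text \<open>The boundary terms vanish because \<open>G\<close> is zero at \<open>R\<close> and
  \<open>- R\<close>. It is meant for \<open>h\<close> a section of \<open>phi\<close> with one
  variable frozen at \<open>a\<close> or \<open>b\<close>.\<close>

lemma integral_deriv_by_parts:
  assumes G: "smooth G" "has_compact_support G"
    and h: "\<And>x. (h has_real_derivative h' x) (at x)" "continuous_on UNIV h'"
  shows "integrable lborel (\<lambda>x. deriv G (x - a) * h x)"
    and "(\<integral>x. deriv G (x - a) * h x \<partial>lborel) = - (\<integral>x. G (x - a) * h' x \<partial>lborel)"
proof -
  obtain R where R: "R > 0" "\<And>x. R \<le> \<bar>x\<bar> \<Longrightarrow> G x = 0" "\<And>x. R \<le> \<bar>x\<bar> \<Longrightarrow> deriv G x = 0"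
    by (rule has_compact_support_vanishes[OF G]) blast
  note [continuous_intros] =
    continuous_on_compose2[OF smooth_continuously_differentiable(2)[OF G(1)]]
  have cont_h: "continuous_on UNIV h"
    using h(1) by (intro continuous_at_imp_continuous_on ballI DERIV_isCont)
  have cont_G': "isCont (\<lambda>x. deriv G (x - a)) x" for x
    by (rule continuous_on_interior[of UNIV]) (auto intro!: continuous_intros)
  have cont_h': "isCont h' x" for x
    by (rule continuous_on_interior[OF h(2)]) auto
  have der: "((\<lambda>x. G (x - a)) has_real_derivative deriv G (x - a)) (at x)" for x
    using DERIV_shift[of G "deriv G (x - a)" x "- a", simplified]
      smooth_continuously_differentiable(1)[OF G(1)] by blast
  have outside: "G (x - a) = 0" "deriv G (x - a) = 0" if "x \<notin> {a - R..a + R}" for x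
    using R(2,3)[of "x - a"] that by auto
  \<comment> \<open>Inserting the indicator changes nothing, as both integrands vanish off the
    interval. It turns integrals over the line into the interval form required for integration by
    parts.\<close>
  have ind: "deriv G (x - a) * h x = indicator {a - R..a + R} x *\<^sub>R (deriv G (x - a) * h x)"
    "G (x - a) * h' x = indicator {a - R..a + R} x *\<^sub>R (G (x - a) * h' x)" for x
    using outside[of x] by (auto simp: indicator_def)
  show "integrable lborel (\<lambda>x. deriv G (x - a) * h x)"
    by (subst ind(1), rule borel_integrable_compact)
      (auto intro!: continuous_intros continuous_on_subset[OF cont_h])
  have "a - R \<le> a + R" using R(1) by simp
  from integral_by_parts'[where F = "\<lambda>x. G (x - a)" and G = h and g = h', OF this cont_G' cont_h' der h(1)]
  have "(\<integral>x. G (x - a) * h' x \<partial>lborel)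
      = G (a + R - a) * h (a + R) - G (a - R - a) * h (a - R)
        - (\<integral>x. deriv G (x - a) * h x \<partial>lborel)"
    by (simp only: ind[symmetric])
  then show "(\<integral>x. deriv G (x - a) * h x \<partial>lborel) = - (\<integral>x. G (x - a) * h' x \<partial>lborel)"
    using R(1) R(2)[of R] R(2)[of "- R"] by simp
qed

text \<open>Fubini for a product of functions in separate variables; \<open>lborel_prod\<close> then
  identifies the product measure with \<open>lborel\<close> on pairs.\<close>

lemma has_bochner_integral_lborel_times:
  fixes f g :: "real \<Rightarrow> real"
  assumes f: "has_bochner_integral lborel f u" and g: "has_bochner_integral lborel g v"
  shows "has_bochner_integral lborel (\<lambda>(x, y). f x * g y) (u * v)"
proof -
  have int_f: "integrable lborel f" and int_g: "integrable lborel g"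
    and eq: "integral\<^sup>L lborel f = u" "integral\<^sup>L lborel g = v"
    using f g by (auto simp: has_bochner_integral_iff)
  have [measurable]: "f \<in> borel_measurable borel" "g \<in> borel_measurable borel"
    using int_f int_g by (auto dest: borel_measurable_integrable)
  have int: "integrable (lborel \<Otimes>\<^sub>M lborel) (\<lambda>(x, y). f x * g y)"
    by (rule lborel_pair.Fubini_integrable) (auto simp: abs_mult int_f int_g)
  moreover have "integral\<^sup>L (lborel \<Otimes>\<^sub>M lborel) (\<lambda>(x, y). f x * g y) = u * v"
    by (simp add: eq flip: lborel_pair.integral_fst[OF int])
  ultimately show ?thesis
    by (simp add: has_bochner_integral_iff lborel_prod)
qed

text \<open>In each variable \<open>phi\<close> has this shape, with \<open>p\<close> the quadratic
  form in the exponent.\<close>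

lemma has_real_derivative_exp_cmult:
  fixes p :: "real \<Rightarrow> real"
  assumes "(p has_real_derivative p') (at x)"
  shows "((\<lambda>x. c * exp (k * p x)) has_real_derivative c * exp (k * p x) * (k * p')) (at x)"
  using assms by (auto intro!: derivative_eq_intros)

text \<open>Supplies the regularity of \<open>h\<close> for integration by parts. Continuity of the
  derivative is read off the explicit formula \<open>D\<close>, which is \<open>phi\<close> times
  the derivative of the exponent.\<close>

lemma phi_continuously_differentiable_fst:
  "((\<lambda>x. phi M B H s r x y) has_real_derivative deriv (\<lambda>x. phi M B H s r x y) x) (at x)"
  "continuous_on UNIV (deriv (\<lambda>x. phi M B H s r x y))"
proof -
  define D where "D x = phi M B H s r x y *
    (- (1 / (2 * (rho M B H s r)\<^sup>2)) * (2 * r powr (2 * H) * x - 2 * mu M B s r * y))" for x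
  have D: "((\<lambda>x. phi M B H s r x y) has_real_derivative D x) (at x)" for x
    unfolding phi_def D_def
    by (intro has_real_derivative_exp_cmult) (auto intro!: derivative_eq_intros)
  then have eq: "deriv (\<lambda>x. phi M B H s r x y) = D"
    by (auto intro: DERIV_imp_deriv)
  show "((\<lambda>x. phi M B H s r x y) has_real_derivative deriv (\<lambda>x. phi M B H s r x y) x) (at x)"
    by (simp add: eq D)
  show "continuous_on UNIV (deriv (\<lambda>x. phi M B H s r x y))"
    unfolding eq unfolding D_def phi_def by (intro continuous_intros)
qed

lemma phi_continuously_differentiable_snd:
  "((\<lambda>y. phi M B H s r x y) has_real_derivative deriv (\<lambda>y. phi M B H s r x y) y) (at y)"
  "continuous_on UNIV (deriv (\<lambda>y. phi M B H s r x y))"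
proof -
  define D where "D y = phi M B H s r x y *
    (- (1 / (2 * (rho M B H s r)\<^sup>2)) * (2 * s powr (2 * H) * y - 2 * mu M B s r * x))" for y
  have D: "((\<lambda>y. phi M B H s r x y) has_real_derivative D y) (at y)" for y
    unfolding phi_def D_def
    by (intro has_real_derivative_exp_cmult) (auto intro!: derivative_eq_intros)
  then have eq: "deriv (\<lambda>y. phi M B H s r x y) = D"
    by (auto intro: DERIV_imp_deriv)
  show "((\<lambda>y. phi M B H s r x y) has_real_derivative deriv (\<lambda>y. phi M B H s r x y) y) (at y)"
    by (simp add: eq D)
  show "continuous_on UNIV (deriv (\<lambda>y. phi M B H s r x y))"
    unfolding eq unfolding D_def phi_def by (intro continuous_intros)
qed

text \<open>The factor \<open>phi\<close> couples \<open>x\<close> and \<open>y\<close>, so the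
  product argument does not apply directly. Instead, the integrand is continuous and vanishes off a
  compact rectangle.\<close>

lemma integrable_deriv_deriv_phi:
  assumes "smooth G1" "has_compact_support G1" "smooth G2" "has_compact_support G2"
  shows "integrable lborel
    (\<lambda>(x, y). deriv G1 (x - a) * deriv G2 (y - b) * phi M B H s r x y)"
proof -
  obtain R1 where R1: "\<And>x. R1 \<le> \<bar>x\<bar> \<Longrightarrow> deriv G1 x = 0"
    by (rule has_compact_support_vanishes[OF assms(1,2)]) blast
  obtain R2 where R2: "\<And>x. R2 \<le> \<bar>x\<bar> \<Longrightarrow> deriv G2 x = 0"
    by (rule has_compact_support_vanishes[OF assms(3,4)]) blast
  let ?K = "{a - R1..a + R1} \<times> {b - R2..b + R2}"
  let ?f = "\<lambda>(x, y). deriv G1 (x - a) * deriv G2 (y - b) * phi M B H s r x y"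
  note [continuous_intros] =
    continuous_on_compose2[OF smooth_continuously_differentiable(2)[OF assms(1)]]
    continuous_on_compose2[OF smooth_continuously_differentiable(2)[OF assms(3)]]
  have "continuous_on ?K ?f"
    unfolding phi_def case_prod_beta by (intro continuous_intros) auto
  then have "integrable lborel (\<lambda>p. indicator ?K p *\<^sub>R ?f p)"
    by (intro borel_integrable_compact compact_Times compact_Icc)
  moreover have "indicator ?K p *\<^sub>R ?f p = ?f p" for p
  proof (cases "p \<in> ?K")
    case False
    then have "R1 \<le> \<bar>fst p - a\<bar> \<or> R2 \<le> \<bar>snd p - b\<bar>"
      by (cases p) auto
    then show ?thesis
      using R1[of "fst p - a"] R2[of "snd p - b"] by (auto simp: case_prod_beta)
  qed simp
  ultimately show ?thesis by (simp only:)
qed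

theorem lemma3p1:
  fixes M :: "'w measure" and B :: "real \<Rightarrow> 'w \<Rightarrow> real" and H :: real
    and G1 G2 :: "real \<Rightarrow> real" and r s a b :: real
  assumes "fractional_brownian_motion M H B"
    and "1 / 2 < H" and "H < 1"
    and "smooth G1" and "has_compact_support G1"
    and "smooth G2" and "has_compact_support G2"
    and "r > 0" and "s > 0" and "r \<noteq> s"
  shows "(\<integral>(x, y). deriv G1 (x - a) * deriv G2 (y - b) * phi M B H s r x y \<partial>(lborel :: (real \<times> real) measure))
      = (\<integral>(x, y). deriv G1 (x - a) * deriv G2 (y - b) * Psi M B H s r a b x y \<partial>(lborel :: (real \<times> real) measure))
        - G2 1 * (\<integral>x. G1 (x - a) * deriv (\<lambda>x'. phi M B H s r x' b) x \<partial>lborel)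
        - G1 1 * (\<integral>y. G2 (y - b) * deriv (\<lambda>y'. phi M B H s r a y') y \<partial>lborel)
        - phi M B H s r a b * G1 1 * G2 1
    \<and> (G1 1 = 0 \<and> G2 1 = 0 \<longrightarrow>
        (\<integral>(x, y). deriv G1 (x - a) * deriv G2 (y - b) * phi M B H s r x y \<partial>(lborel :: (real \<times> real) measure))
        = (\<integral>(x, y). deriv G1 (x - a) * deriv G2 (y - b) * Psi M B H s r a b x y \<partial>(lborel :: (real \<times> real) measure)))"
proof -
  note G1 = assms(4,5) and G2 = assms(6,7)
  let ?\<phi> = "phi M B H s r"
  let ?I = "\<integral>(x, y). deriv G1 (x - a) * deriv G2 (y - b) * ?\<phi> x y \<partial>lborel"
  let ?I1 = "\<integral>x. G1 (x - a) * deriv (\<lambda>x'. ?\<phi> x' b) x \<partial>lborel"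
  let ?I2 = "\<integral>y. G2 (y - b) * deriv (\<lambda>y'. ?\<phi> a y') y \<partial>lborel"
  note theta1 = has_bochner_integral_deriv_theta[OF G1, of a]
    and theta2 = has_bochner_integral_deriv_theta[OF G2, of b]
  have parts1: "has_bochner_integral lborel (\<lambda>x. deriv G1 (x - a) * ?\<phi> x b) (- ?I1)"
    unfolding has_bochner_integral_iff
    by (intro conjI integral_deriv_by_parts[OF G1 phi_continuously_differentiable_fst])
  have parts2: "has_bochner_integral lborel (\<lambda>y. deriv G2 (y - b) * ?\<phi> a y) (- ?I2)"
    unfolding has_bochner_integral_iff
    by (intro conjI integral_deriv_by_parts[OF G2 phi_continuously_differentiable_snd])
  have main: "has_bochner_integral lborel
      (\<lambda>(x, y). deriv G1 (x - a) * deriv G2 (y - b) * ?\<phi> x y) ?I"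
    using integrable_deriv_deriv_phi[OF G1 G2] by (simp add: has_bochner_integral_iff)
  \<comment> \<open>The corrections in \<open>Psi\<close> are grouped as a function of
    \<open>x\<close> times a function of \<open>y\<close>. Working with
    \<open>has_bochner_integral\<close> carries integrability along with the values, so linearity
    applies to all four terms at once.\<close>
  have "has_bochner_integral lborel
      (\<lambda>p. (case p of (x, y) \<Rightarrow> deriv G1 (x - a) * deriv G2 (y - b) * ?\<phi> x y)
        - (case p of (x, y) \<Rightarrow> deriv G1 (x - a) * ?\<phi> x b * (deriv G2 (y - b) * theta (1 + b - y)))
        - (case p of (x, y) \<Rightarrow> deriv G1 (x - a) * theta (1 + a - x) * (deriv G2 (y - b) * ?\<phi> a y))
        + ?\<phi> a b * (case p of (x, y) \<Rightarrow> deriv G1 (x - a) * theta (1 + a - x)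
            * (deriv G2 (y - b) * theta (1 + b - y))))
      (?I - (- ?I1) * G2 1 - G1 1 * (- ?I2) + ?\<phi> a b * (G1 1 * G2 1))"
    by (intro has_bochner_integral_add has_bochner_integral_diff has_bochner_integral_mult_right
        has_bochner_integral_lborel_times main parts1 parts2 theta1 theta2)
  moreover have "(\<lambda>p. (case p of (x, y) \<Rightarrow> deriv G1 (x - a) * deriv G2 (y - b) * ?\<phi> x y)
        - (case p of (x, y) \<Rightarrow> deriv G1 (x - a) * ?\<phi> x b * (deriv G2 (y - b) * theta (1 + b - y)))
        - (case p of (x, y) \<Rightarrow> deriv G1 (x - a) * theta (1 + a - x) * (deriv G2 (y - b) * ?\<phi> a y))
        + ?\<phi> a b * (case p of (x, y) \<Rightarrow> deriv G1 (x - a) * theta (1 + a - x)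
            * (deriv G2 (y - b) * theta (1 + b - y))))
      = (\<lambda>(x, y). deriv G1 (x - a) * deriv G2 (y - b) * Psi M B H s r a b x y)"
    by (auto simp: fun_eq_iff Psi_def algebra_simps)
  ultimately have "(\<integral>(x, y). deriv G1 (x - a) * deriv G2 (y - b) * Psi M B H s r a b x y \<partial>lborel)
      = ?I - (- ?I1) * G2 1 - G1 1 * (- ?I2) + ?\<phi> a b * (G1 1 * G2 1)"
    by (simp add: has_bochner_integral_iff)
  \<comment> \<open>Solving for \<open>?I\<close> gives the first identity; each of its correction
    terms contains \<open>G1 1\<close> or \<open>G2 1\<close>, which gives the second.\<close>
  then show ?thesis by simp
qed

end
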